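(* Let $m,n\ge1$ be integers and $0<\theta\le1$. The extended occupancy distribution satisfies the following recursive/differential equations: (i) for every integer $k\ge0$, $$\operatorname{Occ}(k\mid n+1,m,\theta)=\theta\cdot\frac{m-k+1}{m}\cdot\operatorname{Occ}(k-1\mid n,m,\theta)+\Big(1-\theta\cdot\frac{m-k}{m}\Big)\cdot\operatorname{Occ}(k\mid n,m,\theta);$$ (ii) for every integer $0\le k\le m$, $$\operatorname{Occ}(k\mid n,m+1,\theta)=\frac{m+1}{m-k+1}\cdot\Big(1-\frac{\theta}{m+1}\Big)^n\cdot\operatorname{Occ}\Big(k\,\Big|\,n,m,\frac{m\theta}{1-\theta+m}\Big);$$ (iii) for every integer $k\ge0$, $$\frac{\partial}{\partial\theta}\operatorname{Occ}(k\mid n,m,\theta)=-\frac{m-k}{m}\cdot\operatorname{Occ}(k\mid n-1,m,\theta)+\frac{m-k+1}{m}\cdot\operatorname{Occ}(k-1\mid n-1,m,\theta).$$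
   Context: Noncentral Stirling numbers of the second kind: for an integer $n\ge0$ and real $\phi$, the numbers $S(n,k,\phi)$, $0\le k\le n$, are defined by the polynomial identity $(x+\phi)^n=\sum_{k=0}^n S(n,k,\phi)(x)_k$, where $(x)_k=\prod_{i=0}^{k-1}(x-i)$; $S(n,k,\phi)=0$ for $k>n$. Extended occupancy distribution: for integers $n\ge0$ (number of balls), $m\ge1$ (number of bins), $k\ge0$ and $0<\theta\le1$ (probability parameter), the probability mass function is $\operatorname{Occ}(k\mid n,m,\theta)=\frac{\theta^n}{m^n}(m)_k\,S\big(n,k,m\tfrac{1-\theta}{\theta}\big)$; and $\operatorname{Occ}(-1\mid n,m,\theta)=0$. This is zero for $k>\min(n,m)$.
   Formalization: Equation (iii) is proved with its right-hand side multiplied by n; as printed it fails for n ≥ 2, e.g. for k = 0, where Occ(0|n,m,θ) = (1−θ)^n has derivative −n(1−θ)^(n−1). At θ = 1 the derivative is the left one. *)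

theory Defs
  imports Complex_Main
begin

definition falling_factorial :: "real \<Rightarrow> nat \<Rightarrow> real" where
  "falling_factorial x k = (\<Prod>i<k. x - real i)"

lemma falling_factorial_0 [simp]: "falling_factorial x 0 = 1"
  by (simp add: falling_factorial_def)

lemma falling_factorial_Suc:
  "falling_factorial x (Suc k) = falling_factorial x k * (x - real k)"
  by (simp add: falling_factorial_def)

lemma falling_factorial_eq_0: "j < k \<Longrightarrow> falling_factorial (real j) k = 0"
  by (auto simp: falling_factorial_def)

lemma falling_factorial_self_neq_0: "falling_factorial (real j) j \<noteq> 0"
  by (simp add: falling_factorial_def)

definition is_stirling_row :: "nat \<Rightarrow> real \<Rightarrow> (nat \<Rightarrow> real) \<Rightarrow> bool" where
  "is_stirling_row n \<phi> s \<longleftrightarrow>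
     (\<forall>k>n. s k = 0) \<and>
     (\<forall>x::real. (x + \<phi>) ^ n = (\<Sum>k\<le>n. s k * falling_factorial x k))"

text \<open>
  Well defined by \<open>ex1_stirling_row\<close> below.
\<close>
definition nc_stirling2 :: "nat \<Rightarrow> nat \<Rightarrow> real \<Rightarrow> real" where
  "nc_stirling2 n k \<phi> = (THE s. is_stirling_row n \<phi> s) k"

lemma ex_stirling_row: "\<exists>s. is_stirling_row n \<phi> s"
proof (induction n)
  case 0
  show ?case
    by (rule exI[of _ "\<lambda>k. if k = 0 then 1 else 0"]) (simp add: is_stirling_row_def)
next
  case (Suc n)
  then obtain s where z: "\<And>k. k > n \<Longrightarrow> s k = 0"
    and s: "\<And>x. (x + \<phi>) ^ n = (\<Sum>k\<le>n. s k * falling_factorial x k)"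
    by (auto simp: is_stirling_row_def)
  define t where "t k = (case k of 0 \<Rightarrow> 0 | Suc j \<Rightarrow> s j) + (real k + \<phi>) * s k" for k
  have "(x + \<phi>) ^ Suc n = (\<Sum>k\<le>Suc n. t k * falling_factorial x k)" for x
  proof -
    have "(\<Sum>k\<le>Suc n. t k * falling_factorial x k) =
        (\<Sum>k\<le>Suc n. (case k of 0 \<Rightarrow> 0 | Suc j \<Rightarrow> s j) * falling_factorial x k)
        + (\<Sum>k\<le>Suc n. (real k + \<phi>) * s k * falling_factorial x k)"
      by (simp only: t_def distrib_right sum.distrib)
    also have "(\<Sum>k\<le>Suc n. (case k of 0 \<Rightarrow> 0 | Suc j \<Rightarrow> s j) * falling_factorial x k)
        = (\<Sum>k\<le>n. s k * falling_factorial x (Suc k))"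
      by (simp only: sum.atMost_Suc_shift) simp
    also have "(\<Sum>k\<le>Suc n. (real k + \<phi>) * s k * falling_factorial x k)
        = (\<Sum>k\<le>n. (real k + \<phi>) * s k * falling_factorial x k)"
      by (simp add: z)
    also have "(\<Sum>k\<le>n. s k * falling_factorial x (Suc k))
          + (\<Sum>k\<le>n. (real k + \<phi>) * s k * falling_factorial x k)
        = (\<Sum>k\<le>n. (x + \<phi>) * (s k * falling_factorial x k))"
      by (simp add: sum.distrib[symmetric] falling_factorial_Suc algebra_simps)
    also have "\<dots> = (x + \<phi>) ^ Suc n"
      by (simp add: s sum_distrib_left)
    finally show ?thesis ..
  qed
  moreover have "t k = 0" if "k > Suc n" for k
    using that z by (auto simp: t_def split: nat.split)
  ultimately show ?case
    by (auto simp only: is_stirling_row_def)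
qed

lemma stirling_row_unique:
  assumes "is_stirling_row n \<phi> s" "is_stirling_row n \<phi> t"
  shows "s = t"
proof
  fix k show "s k = t k"
  proof (induction k rule: less_induct)
    case (less k)
    show ?case
    proof (cases "k \<le> n")
      case True
      have split: "(\<Sum>i\<le>n. u i * falling_factorial (real k) i)
          = (\<Sum>i<k. u i * falling_factorial (real k) i) + u k * falling_factorial (real k) k"
        for u :: "nat \<Rightarrow> real"
      proof -
        have "(\<Sum>i\<le>n. u i * falling_factorial (real k) i)
            = (\<Sum>i\<le>k. u i * falling_factorial (real k) i)"
          using True by (intro sum.mono_neutral_right) (auto simp: falling_factorial_eq_0)
        then show ?thesis
          by (simp flip: lessThan_Suc_atMost)
      qed
      have "(\<Sum>i\<le>n. s i * falling_factorial (real k) i)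
          = (\<Sum>i\<le>n. t i * falling_factorial (real k) i)"
        using assms unfolding is_stirling_row_def by metis
      then have "s k * falling_factorial (real k) k = t k * falling_factorial (real k) k"
        using less by (simp add: split)
      then show ?thesis
        by (simp add: falling_factorial_self_neq_0)
    next
      case False
      then show ?thesis using assms by (simp add: is_stirling_row_def)
    qed
  qed
qed

lemma ex1_stirling_row: "\<exists>!s. is_stirling_row n \<phi> s"
  using ex_stirling_row stirling_row_unique by blast

lemma is_stirling_row_nc_stirling2: "is_stirling_row n \<phi> (\<lambda>k. nc_stirling2 n k \<phi>)"
  using theI'[OF ex1_stirling_row[of n \<phi>]] by (simp add: nc_stirling2_def)

text \<open>
  The first argument is an integer because the recursions below refer to the value at \<open>-1\<close>.
  The formula is the intended one for \<open>m \<ge> 1\<close> and \<open>0 < \<theta> \<le> 1\<close> only.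
\<close>
definition occ :: "int \<Rightarrow> nat \<Rightarrow> nat \<Rightarrow> real \<Rightarrow> real" where
  "occ k n m \<theta> =
     (if k < 0 then 0
      else \<theta> ^ n / real m ^ n * falling_factorial (real m) (nat k) *
           nc_stirling2 n (nat k) (real m * ((1 - \<theta>) / \<theta>)))"

text \<open>
  By the next lemma the derivative of \<open>occ 0 n m\<close> is \<open>- n * (1 - \<theta>) ^ (n - 1)\<close>, that is
  \<open>- n * occ 0 (n - 1) m \<theta>\<close>. So the differential equation for \<open>occ\<close> needs a factor \<open>n\<close> on
  its right-hand side; it is sometimes printed without that factor, and is then false for
  every \<open>n \<ge> 2\<close>.
\<close>
lemma occ_0:
  assumes "m \<ge> 1" "0 < \<theta>"
  shows "occ 0 n m \<theta> = (1 - \<theta>) ^ n"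
proof -
  have "\<phi> ^ n = nc_stirling2 n 0 \<phi>" for \<phi>
  proof -
    have "(0 + \<phi>) ^ n = (\<Sum>k\<le>n. nc_stirling2 n k \<phi> * falling_factorial 0 k)"
      using is_stirling_row_nc_stirling2[of n \<phi>] unfolding is_stirling_row_def by blast
    also have "\<dots> = (\<Sum>k\<in>{0}. nc_stirling2 n k \<phi> * falling_factorial 0 k)"
      using falling_factorial_eq_0[of 0] by (intro sum.mono_neutral_right) auto
    finally show ?thesis by simp
  qed
  then have "occ 0 n m \<theta> = \<theta> ^ n / real m ^ n * (real m * ((1 - \<theta>) / \<theta>)) ^ n"
    by (simp add: occ_def)
  also have "\<dots> = (1 - \<theta>) ^ n"
    using assms by (simp add: power_mult_distrib power_divide)
  finally show ?thesis .
qed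

end

theory Submission
  imports Defs
begin

text \<open>
  Multiplying the defining identity by \<open>x + \<phi> = (x - k) + (k + \<phi>)\<close> gives the recurrence
  \<open>S(n + 1, k, \<phi>) = S(n, k - 1, \<phi>) + (k + \<phi>) S(n, k, \<phi>)\<close>, and by induction
  \<open>\<partial>S(n, k, \<phi>)/\<partial>\<phi> = n S(n - 1, k, \<phi>)\<close>. The recurrence yields (i). Part (ii) holds because
  both sides have the same noncentrality parameter. For (iii), differentiating the product
  \<open>\<theta>\<^sup>n S(n, k, m (1 - \<theta>)/\<theta>)\<close> and applying the recurrence leaves the coefficient
  \<open>k + \<phi> - m/\<theta> = k - m\<close>.
\<close>

text \<open>Stated for rows because \<open>nc_stirling2\<close> is a definite description:
  uniqueness of rows then turns this into the recurrence for the numbers themselves.\<close>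

lemma is_stirling_row_Suc:
  assumes "is_stirling_row n \<phi> s"
  shows "is_stirling_row (Suc n) \<phi>
           (\<lambda>k. (case k of 0 \<Rightarrow> 0 | Suc j \<Rightarrow> s j) + (real k + \<phi>) * s k)"
    (is "is_stirling_row _ _ ?t")
proof -
  have zero: "s k = 0" if "k > n" for k
    using assms that by (simp add: is_stirling_row_def)
  have "(x + \<phi>) ^ Suc n = (\<Sum>k\<le>Suc n. ?t k * falling_factorial x k)" for x
  proof -
    have "(\<Sum>k\<le>Suc n. ?t k * falling_factorial x k)
        = (\<Sum>k\<le>Suc n. (case k of 0 \<Rightarrow> 0 | Suc j \<Rightarrow> s j) * falling_factorial x k)
          + (\<Sum>k\<le>Suc n. (real k + \<phi>) * s k * falling_factorial x k)"
      by (simp only: distrib_right sum.distrib)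
    also have "\<dots> = (\<Sum>k\<le>n. s k * falling_factorial x (Suc k))
          + (\<Sum>k\<le>n. (real k + \<phi>) * s k * falling_factorial x k)"
      by (subst sum.atMost_Suc_shift) (simp add: zero)
    also have "\<dots> = (x + \<phi>) * (\<Sum>k\<le>n. s k * falling_factorial x k)"
      by (simp add: sum.distrib [symmetric] sum_distrib_left falling_factorial_Suc algebra_simps)
    also have "\<dots> = (x + \<phi>) ^ Suc n"
      using assms by (simp add: is_stirling_row_def)
    finally show ?thesis ..
  qed
  moreover have "?t k = 0" if "k > Suc n" for k
    using that zero by (auto split: nat.split)
  ultimately show ?thesis
    by (auto simp only: is_stirling_row_def)
qed

lemma nc_stirling2_Suc:
  "nc_stirling2 (Suc n) k \<phi> =
     (case k of 0 \<Rightarrow> 0 | Suc j \<Rightarrow> nc_stirling2 n j \<phi>) + (real k + \<phi>) * nc_stirling2 n k \<phi>"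
  using stirling_row_unique [OF is_stirling_row_nc_stirling2
      is_stirling_row_Suc [OF is_stirling_row_nc_stirling2]]
  by (rule fun_cong)

lemma nc_stirling2_0: "nc_stirling2 0 k \<phi> = (if k = 0 then 1 else 0)"
proof -
  have "is_stirling_row 0 \<phi> (\<lambda>k. if k = 0 then 1 else 0)"
    by (simp add: is_stirling_row_def)
  from stirling_row_unique [OF is_stirling_row_nc_stirling2 this] show ?thesis
    by (rule fun_cong)
qed

lemma has_real_derivative_nc_stirling2:
  "((\<lambda>\<phi>. nc_stirling2 n k \<phi>) has_real_derivative real n * nc_stirling2 (n - 1) k \<phi>)
     (at \<phi> within A)"
proof (induction n arbitrary: k)
  case 0
  show ?case by (simp add: nc_stirling2_0)
next
  case (Suc n)
  have shifted: "((\<lambda>\<phi>. case k of 0 \<Rightarrow> 0 | Suc j \<Rightarrow> nc_stirling2 n j \<phi>) has_real_derivative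
      (case k of 0 \<Rightarrow> 0 | Suc j \<Rightarrow> real n * nc_stirling2 (n - 1) j \<phi>)) (at \<phi> within A)"
    using Suc.IH by (cases k) auto
  \<comment> \<open>This is \<open>n\<close> times the recurrence one level down; for
    \<open>n = 0\<close> both sides vanish. The factor \<open>real k + \<phi>\<close> contributes
    one further \<open>nc_stirling2 n k \<phi>\<close> through the product rule, which raises
    \<open>n\<close> to \<open>n + 1\<close>.\<close>
  have "real n * nc_stirling2 n k \<phi> =
      (case k of 0 \<Rightarrow> 0 | Suc j \<Rightarrow> real n * nc_stirling2 (n - 1) j \<phi>)
      + (real k + \<phi>) * (real n * nc_stirling2 (n - 1) k \<phi>)"
    by (cases n) (auto simp: nc_stirling2_Suc algebra_simps split: nat.split)
  then show ?case
    unfolding nc_stirling2_Suc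
    by (auto intro!: derivative_eq_intros shifted Suc.IH simp: algebra_simps)
qed

lemma occ_of_nat:
  "occ (int k) n m \<theta> =
     (\<theta> / real m) ^ n * falling_factorial (real m) k *
     nc_stirling2 n k (real m * ((1 - \<theta>) / \<theta>))"
  by (simp add: occ_def power_divide)

text \<open>The factor \<open>m - k + 1\<close> completes the falling factorial of length
  \<open>k - 1\<close> to length \<open>k\<close>, so both occupancy terms share one prefactor. For
  \<open>k = 0\<close> the value at \<open>-1\<close> matches the zero branch of the case
  expression.\<close>

lemma occ_of_nat_pred:
  "(real m - real k + 1) * occ (int k - 1) n m \<theta> =
     (\<theta> / real m) ^ n * falling_factorial (real m) k *
     (case k of 0 \<Rightarrow> 0 | Suc j \<Rightarrow> nc_stirling2 n j (real m * ((1 - \<theta>) / \<theta>)))"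
  by (cases k) (auto simp: occ_def power_divide falling_factorial_Suc)

lemma occ_Suc_balls:
  assumes "m \<ge> 1" and "\<theta> > 0"
  shows "occ (int k) (Suc n) m \<theta> =
    \<theta> * ((real m - real k + 1) / real m) * occ (int k - 1) n m \<theta>
    + (1 - \<theta> * ((real m - real k) / real m)) * occ (int k) n m \<theta>"
proof -
  define \<phi> where "\<phi> = real m * ((1 - \<theta>) / \<theta>)"
  \<comment> \<open>The probability of hitting no new bin is the recurrence coefficient
    \<open>k + \<phi>\<close>, rescaled by the extra factor \<open>\<theta> / m\<close> of the added
    ball.\<close>
  have \<phi>: "1 - \<theta> * ((real m - real k) / real m) = \<theta> / real m * (real k + \<phi>)"
    using assms by (simp add: \<phi>_def field_simps)
  have "occ (int k) (Suc n) m \<theta> =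
      \<theta> / real m * ((\<theta> / real m) ^ n * falling_factorial (real m) k *
        (case k of 0 \<Rightarrow> 0 | Suc j \<Rightarrow> nc_stirling2 n j \<phi>))
      + \<theta> / real m * (real k + \<phi>) * occ (int k) n m \<theta>"
    unfolding occ_of_nat nc_stirling2_Suc \<phi>_def [symmetric] by (simp only: power_Suc) algebra
  also have "\<dots> = \<theta> / real m * ((real m - real k + 1) * occ (int k - 1) n m \<theta>)
      + \<theta> / real m * (real k + \<phi>) * occ (int k) n m \<theta>"
    by (simp only: occ_of_nat_pred \<phi>_def)
  finally show ?thesis
    unfolding \<phi> by (simp add: mult_ac)
qed

text \<open>Both sides are the falling factorial of \<open>x + 1\<close> of length
  \<open>k + 1\<close>, with its last or its first factor split off.\<close>

lemma falling_factorial_add_1: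
  "(x + 1 - real k) * falling_factorial (x + 1) k = (x + 1) * falling_factorial x k"
proof (induction k)
  case (Suc k)
  then show ?case
    unfolding falling_factorial_Suc of_nat_Suc by algebra
qed simp

lemma occ_Suc_bins:
  assumes "m \<ge> 1" and "0 < \<theta>" and "\<theta> \<le> 1" and "k \<le> m"
  shows "occ (int k) n (m + 1) \<theta> =
    (real m + 1) / (real m - real k + 1) * (1 - \<theta> / (real m + 1)) ^ n
    * occ (int k) n m (real m * \<theta> / (1 - \<theta> + real m))"
proof -
  define \<theta>' where "\<theta>' = real m * \<theta> / (1 - \<theta> + real m)"
  have pos: "1 - \<theta> + real m > 0"
    using assms by simp
  \<comment> \<open>This equation determines \<open>\<theta>'\<close>: the Stirling factors on both
    sides coincide, and only powers and falling factorials remain to be compared.\<close>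
  have \<phi>: "real m * ((1 - \<theta>') / \<theta>') = real (m + 1) * ((1 - \<theta>) / \<theta>)"
    using assms pos by (simp add: \<theta>'_def divide_simps) algebra
  have "(1 - \<theta> / (real m + 1)) * (\<theta>' / real m) = \<theta> / real (m + 1)"
    using assms pos by (simp add: \<theta>'_def divide_simps) algebra
  then have scale: "(\<theta> / real (m + 1)) ^ n = (1 - \<theta> / (real m + 1)) ^ n * (\<theta>' / real m) ^ n"
    by (simp only: power_mult_distrib [symmetric])
  \<comment> \<open>Here \<open>k \<le> m\<close> keeps the denominator \<open>m - k + 1\<close>
    positive.\<close>
  have ff: "falling_factorial (real (m + 1)) k =
      (real m + 1) / (real m - real k + 1) * falling_factorial (real m) k"
    using falling_factorial_add_1 [of "real m" k] assms by (simp add: field_simps)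
  show ?thesis
    unfolding \<theta>'_def [symmetric] occ_of_nat \<phi> scale ff by (simp add: mult_ac)
qed

text \<open>The set \<open>A\<close> is arbitrary, so the one-sided derivative at
  \<open>\<theta> = 1\<close> is covered as well.\<close>

lemma has_real_derivative_occ:
  assumes "m \<ge> 1" and "n \<ge> 1" and "\<theta> > 0"
  shows "((\<lambda>t. occ (int k) n m t) has_real_derivative
    real n * (- ((real m - real k) / real m) * occ (int k) (n - 1) m \<theta>
      + (real m - real k + 1) / real m * occ (int k - 1) (n - 1) m \<theta>)) (at \<theta> within A)"
proof -
  obtain l where n: "n = Suc l"
    using assms by (cases n) auto
  define \<phi> where "\<phi> t = real m * ((1 - t) / t)" for t
  define c where "c = falling_factorial (real m) k"
  \<comment> \<open>\<open>n * p\<close> is the derivative of the power \<open>(t / m) ^ n\<close>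
    at \<open>\<theta>\<close>. By the recurrence, \<open>T + (k + \<phi> \<theta>) * S\<close>
    below is the Stirling number of level \<open>n\<close>.\<close>
  define p where "p = (\<theta> / real m) ^ l / real m"
  define S where "S = nc_stirling2 l k (\<phi> \<theta>)"
  define T where "T = (case k of 0 \<Rightarrow> 0 | Suc j \<Rightarrow> nc_stirling2 l j (\<phi> \<theta>))"
  have \<phi>_deriv: "(\<phi> has_real_derivative - (real m / \<theta>\<^sup>2)) (at \<theta> within A)"
    unfolding \<phi>_def using assms
    by (auto intro!: derivative_eq_intros simp: field_simps power2_eq_square)
  have S_deriv: "((\<lambda>t. nc_stirling2 n k (\<phi> t)) has_real_derivative
      real n * S * - (real m / \<theta>\<^sup>2)) (at \<theta> within A)"
    using DERIV_chain2 [OF has_real_derivative_nc_stirling2 \<phi>_deriv, of n k]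
    by (simp add: n S_def)
  have pow_deriv: "((\<lambda>t. (t / real m) ^ n * c) has_real_derivative
      real n * p * c) (at \<theta> within A)"
    using DERIV_cmult_right [OF DERIV_power_Suc [OF DERIV_cdivide [OF DERIV_ident]]]
    by (simp add: n p_def)
  have "real n * p * c * (T + (real k + \<phi> \<theta>) * S)
      + real n * S * - (real m / \<theta>\<^sup>2) * ((\<theta> / real m) ^ n * c)
      = real n * p * c * (T + (real k + \<phi> \<theta> - real m / \<theta>) * S)"
  proof -
    \<comment> \<open>Extracting \<open>p\<close> from the chain-rule term lets it merge with the
      power-rule term; the rest is a polynomial identity in free variables.\<close>
    have "real m / \<theta>\<^sup>2 * (\<theta> / real m) ^ n = p * (real m / \<theta>)"
      using assms by (simp add: n p_def power2_eq_square)
    moreover have "real n * p * c * (T + u * S) + real n * S * - x * (y * c)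
        = real n * p * c * (T + (u - z) * S)" if "x * y = p * z" for u x y z
      using that by algebra
    ultimately show ?thesis by blast
  qed
  also have "real k + \<phi> \<theta> - real m / \<theta> = - (real m - real k)"
    using assms by (simp add: \<phi>_def field_simps)
  also have "real n * p * c * (T + - (real m - real k) * S)
      = real n * (- (real m - real k) * (p * c * S) + p * c * T)"
    by algebra
  also have "p * c * S = occ (int k) (n - 1) m \<theta> / real m"
    by (simp add: n occ_of_nat p_def c_def S_def \<phi>_def)
  also have "p * c * T = (real m - real k + 1) / real m * occ (int k - 1) (n - 1) m \<theta>"
    using occ_of_nat_pred [of m k l \<theta>] unfolding n p_def c_def T_def \<phi>_def by simp
  finally have "real n * p * c * (T + (real k + \<phi> \<theta>) * S)
      + real n * S * - (real m / \<theta>\<^sup>2) * ((\<theta> / real m) ^ n * c)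
      = real n * (- ((real m - real k) / real m) * occ (int k) (n - 1) m \<theta>
        + (real m - real k + 1) / real m * occ (int k - 1) (n - 1) m \<theta>)"
    by (simp only: minus_mult_left times_divide_eq_left times_divide_eq_right minus_divide_left)
  moreover have "((\<lambda>t. occ (int k) n m t) has_real_derivative
      real n * p * c * (T + (real k + \<phi> \<theta>) * S)
      + real n * S * - (real m / \<theta>\<^sup>2) * ((\<theta> / real m) ^ n * c)) (at \<theta> within A)"
    using DERIV_mult [OF pow_deriv S_deriv]
    unfolding occ_of_nat c_def \<phi>_def [symmetric]
    by (simp add: n nc_stirling2_Suc S_def T_def)
  ultimately show ?thesis
    by (simp only:)
qed

theorem theorem5:
  fixes m n :: nat and \<theta> :: real
  assumes "m \<ge> 1" and "n \<ge> 1" and "0 < \<theta>" and "\<theta> \<le> 1"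
  shows
    "(\<forall>k::int. k \<ge> 0 \<longrightarrow>
        occ k (n + 1) m \<theta> =
          \<theta> * ((real m - real_of_int k + 1) / real m) * occ (k - 1) n m \<theta>
          + (1 - \<theta> * ((real m - real_of_int k) / real m)) * occ k n m \<theta>)
     \<and>
     (\<forall>k::int. 0 \<le> k \<and> k \<le> int m \<longrightarrow>
        occ k n (m + 1) \<theta> =
          (real m + 1) / (real m - real_of_int k + 1) * (1 - \<theta> / (real m + 1)) ^ n
          * occ k n m (real m * \<theta> / (1 - \<theta> + real m)))
     \<and>
     (\<forall>k::int. k \<ge> 0 \<longrightarrow>
        ((\<lambda>t. occ k n m t) has_real_derivative
          real n *
          (- ((real m - real_of_int k) / real m) * occ k (n - 1) m \<theta>
           + (real m - real_of_int k + 1) / real m * occ (k - 1) (n - 1) m \<theta>))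
        (at \<theta> within {0<..1}))"
\<comment> \<open>Splitting the conjunction \<open>0 \<le> k \<and> k \<le> int m\<close> lets all
  three parts share one fixed \<open>k\<close> and its natural counterpart \<open>j\<close>.\<close>
proof (intro conjI allI impI; (elim conjE)?)
  fix k :: int
  assume "k \<ge> 0"
  then obtain j where k: "k = int j"
    using nonneg_int_cases by blast
  show "occ k (n + 1) m \<theta> =
      \<theta> * ((real m - real_of_int k + 1) / real m) * occ (k - 1) n m \<theta>
      + (1 - \<theta> * ((real m - real_of_int k) / real m)) * occ k n m \<theta>"
    using occ_Suc_balls [of m \<theta> j n] assms by (simp add: k)
  show "((\<lambda>t. occ k n m t) has_real_derivative
      real n *
      (- ((real m - real_of_int k) / real m) * occ k (n - 1) m \<theta>
       + (real m - real_of_int k + 1) / real m * occ (k - 1) (n - 1) m \<theta>))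
      (at \<theta> within {0<..1})"
    using has_real_derivative_occ [of m n \<theta> j] assms by (simp add: k)
  assume "k \<le> int m"
  then show "occ k n (m + 1) \<theta> =
      (real m + 1) / (real m - real_of_int k + 1) * (1 - \<theta> / (real m + 1)) ^ n
      * occ k n m (real m * \<theta> / (1 - \<theta> + real m))"
    using occ_Suc_bins [of m \<theta> j n] assms by (simp add: k)
qed

end
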